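(* Let $M'=M[U',L']$ and $M=M[U,L]$ be lattice path matroids on the ground set $[n]$. Then $M'\leq_Q M$ if and only if $U'\subseteq U$, $L'\subseteq L$ and the greedy pairing of $(L\setminus L',U\setminus U')$ is good.
   Context: $[n]=\{1,\dots,n\}$. For $A,B\in\binom{[n]}{k}$ with $A=\{a_1<\dots<a_k\}$, $B=\{b_1<\dots<b_k\}$, the Gale order is: $A\leq_G B$ iff $a_i\leq b_i$ for all $i\in[k]$. For $0\leq k\leq n$ and $U,L\in\binom{[n]}{k}$ with $U\leq_G L$, the lattice path matroid (LPM) $M[U,L]$ is the matroid of rank $k$ on $[n]$ with set of bases $\{B\in\binom{[n]}{k} : U\leq_G B\leq_G L\}$. Quotients: for matroids $M,M'$ on $[n]$ with sets of bases $\mathcal B,\mathcal B'$, $M'$ is a quotient of $M$, written $M'\leq_Q M$, if for all $B\in\mathcal B$ and $p\in[n]\setminus B$ there is $B'\in\mathcal B'$ with $B'\subseteq B$ such that for all $q\in B'$: if $(B'\cup\{p\})\setminus\{q\}\in\mathcal B'$ then $(B\cup\{p\})\setminus\{q\}\in\mathcal B$. Good pairs: for an LPM $M[U,L]$ with $U=\{u_1<\dots<u_k\}$, $L=\{\ell_1<\dots<\ell_k\}$ and $1\leq i,j\leq k$, the pair $(\ell_i,u_j)$ is a good pair of $M[U,L]$ if $i\leq j$ and $u_j-\ell_i\leq j-i$. Greedy pairing: given subsets $\widetilde U=\{u_{i_1}<\dots<u_{i_z}\}\subseteq U$ and $\widetilde L=\{\ell_{j_1}<\dots<\ell_{j_z}\}\subseteq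 L$ of equal size $z$, the greedy pairing of $(\widetilde L,\widetilde U)$ is the sequence $((\ell_{j_1},u_{i_1}),\dots,(\ell_{j_z},u_{i_z}))$. It is good if for every $1\leq r\leq z$ the pair $(\ell_{j_r},u_{i_r})$ is a good pair of the LPM $M[U\setminus\{u_{i_1},\dots,u_{i_{r-1}}\},\,L\setminus\{\ell_{j_1},\dots,\ell_{j_{r-1}}\}]$ (with indices taken relative to the elements of these smaller sets). *)

theory Defs
  imports "HOL-Library.Ramsey"
begin

locale matroid =
  fixes E :: "'a set" and \<B> :: "'a set set"
  assumes finite_ground: "finite E"
    and bases_subset: "B \<in> \<B> \<Longrightarrow> B \<subseteq> E"
    and bases_nonempty: "\<B> \<noteq> {}"
    and basis_exchange:
      "\<lbrakk>A \<in> \<B>; B \<in> \<B>; a \<in> A - B\<rbrakk> \<Longrightarrow> \<exists>b\<in>B - A. insert b (A - {a}) \<in> \<B>"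

definition matroid_quotient :: "'a set \<Rightarrow> 'a set set \<Rightarrow> 'a set set \<Rightarrow> bool" where
  \<comment> \<open>the matroid on \<open>E\<close> with bases \<open>\<B>'\<close> is a quotient of the one with bases \<open>\<B>\<close>\<close>
  "matroid_quotient E \<B>' \<B> \<longleftrightarrow>
    (\<forall>B\<in>\<B>. \<forall>p\<in>E - B. \<exists>B'\<in>\<B>'. B' \<subseteq> B \<and>
      (\<forall>q\<in>B'. (B' \<union> {p}) - {q} \<in> \<B>' \<longrightarrow> (B \<union> {p}) - {q} \<in> \<B>))"

definition elem :: "nat set \<Rightarrow> nat \<Rightarrow> nat" where
  \<comment> \<open>for finite \<open>A\<close> with elements \<open>a\<^sub>1 < \<dots> < a\<^sub>k\<close> and \<open>1 \<le> i \<le> k\<close>, this is \<open>a\<^sub>i\<close>\<close>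
  "elem A i = sorted_list_of_set A ! (i - 1)"

definition gale_le :: "nat set \<Rightarrow> nat set \<Rightarrow> bool" (infix "\<le>\<^sub>G" 50) where
  "A \<le>\<^sub>G B \<longleftrightarrow> card A = card B \<and> (\<forall>i\<in>{1..card A}. elem A i \<le> elem B i)"

definition lpm :: "nat \<Rightarrow> nat set \<Rightarrow> nat set \<Rightarrow> nat set set" where
  \<comment> \<open>the bases of the lattice path matroid \<open>M[U,L]\<close> on \<open>{1..n}\<close>\<close>
  "lpm n U L = {B \<in> nsets {1..n} (card U). U \<le>\<^sub>G B \<and> B \<le>\<^sub>G L}"

definition good_pair :: "nat set \<Rightarrow> nat set \<Rightarrow> nat \<times> nat \<Rightarrow> bool" where
  \<comment> \<open>the difference \<open>u\<^sub>j - l\<^sub>i\<close> may be negative, hence the integers\<close>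
  "good_pair U L p \<longleftrightarrow>
    (\<exists>i\<in>{1..card L}. \<exists>j\<in>{1..card U}. p = (elem L i, elem U j) \<and>
      i \<le> j \<and> int (elem U j) - int (elem L i) \<le> int j - int i)"

definition greedy_pairing :: "nat set \<Rightarrow> nat set \<Rightarrow> (nat \<times> nat) list" where
  "greedy_pairing Lt Ut = zip (sorted_list_of_set Lt) (sorted_list_of_set Ut)"

definition good_pairing :: "nat set \<Rightarrow> nat set \<Rightarrow> (nat \<times> nat) list \<Rightarrow> bool" where
  \<comment> \<open>\<open>r\<close> counts from 0, so exactly the pairs preceding \<open>ps ! r\<close> have been removed\<close>
  "good_pairing U L ps \<longleftrightarrow>
    (\<forall>r<length ps. good_pair (U - snd ` set (take r ps)) (L - fst ` set (take r ps)) (ps ! r))"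


text \<open>The Gale order in terms of initial segments, and the fact that \<^term>\<open>lpm n U L\<close>
  is the set of bases of a matroid.\<close>

lemma nth_sorted_list_le_iff:
  assumes "finite A" "i < card A"
  shows "sorted_list_of_set A ! i \<le> x \<longleftrightarrow> i < card (A \<inter> {..x})"
proof -
  define xs where "xs = sorted_list_of_set A"
  have xs: "sorted xs" "distinct xs" "set xs = A" "length xs = card A"
    using assms by (auto simp: xs_def)
  have "card (A \<inter> {..x}) = length (filter (\<lambda>y. y \<le> x) xs)"
    using xs distinct_card[of "filter (\<lambda>y. y \<le> x) xs"]
    by (simp add: Int_def Collect_conj_eq[symmetric])
  also have "filter (\<lambda>y. y \<le> x) xs = takeWhile (\<lambda>y. y \<le> x) xs"
    using xs(1)
  proof (induction xs)
    case (Cons a ys)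
    have "filter (\<lambda>y. y \<le> x) ys = []" if "\<not> a \<le> x"
      using Cons.prems that by (auto simp: filter_empty_conv)
    then show ?case using Cons by simp
  qed simp
  finally have c: "card (A \<inter> {..x}) = length (takeWhile (\<lambda>y. y \<le> x) xs)" .
  show ?thesis
  proof
    assume le: "sorted_list_of_set A ! i \<le> x"
    show "i < card (A \<inter> {..x})"
    proof (rule ccontr)
      assume "\<not> ?thesis"
      then have l: "length (takeWhile (\<lambda>y. y \<le> x) xs) \<le> i"
        using c by simp
      then have "\<not> xs ! length (takeWhile (\<lambda>y. y \<le> x) xs) \<le> x"
        using nth_length_takeWhile[of "\<lambda>y. y \<le> x" xs] xs(4) assms(2) by simp
      moreover have "xs ! length (takeWhile (\<lambda>y. y \<le> x) xs) \<le> xs ! i"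
        using l xs assms(2) by (simp add: sorted_nth_mono)
      ultimately show False using le by (simp add: xs_def)
    qed
  next
    assume "i < card (A \<inter> {..x})"
    then have "i < length (takeWhile (\<lambda>y. y \<le> x) xs)"
      using c by simp
    then show "sorted_list_of_set A ! i \<le> x"
      unfolding xs_def[symmetric]
      by (metis nth_mem set_takeWhileD takeWhile_nth)
  qed
qed

lemma gale_le_iff_count:
  assumes "finite A" "finite B"
  shows "A \<le>\<^sub>G B \<longleftrightarrow>
    card A = card B \<and> (\<forall>x. card (B \<inter> {..x}) \<le> card (A \<inter> {..x}))"
proof (cases "card A = card B")
  case eq: True
  have "(\<forall>i\<in>{1..card A}. elem A i \<le> elem B i) \<longleftrightarrow>
      (\<forall>i<card A. sorted_list_of_set A ! i \<le> sorted_list_of_set B ! i)"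
    unfolding elem_def image_Suc_lessThan[symmetric] One_nat_def[symmetric]
    by (simp add: lessThan_def)
  also have "\<dots> \<longleftrightarrow> (\<forall>x. card (B \<inter> {..x}) \<le> card (A \<inter> {..x}))"
  proof (intro iffI allI impI)
    fix x assume le: "\<forall>i<card A. sorted_list_of_set A ! i \<le> sorted_list_of_set B ! i"
    show "card (B \<inter> {..x}) \<le> card (A \<inter> {..x})"
    proof (rule ccontr)
      assume less: "\<not> ?thesis"
      have "card (B \<inter> {..x}) \<le> card B"
        using assms by (simp add: card_mono)
      then have i: "card (A \<inter> {..x}) < card A" "card (A \<inter> {..x}) < card B"
        using eq less by auto
      then have "sorted_list_of_set B ! card (A \<inter> {..x}) \<le> x"
        using nth_sorted_list_le_iff[OF assms(2) i(2), of x] less by simp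
      then have "sorted_list_of_set A ! card (A \<inter> {..x}) \<le> x"
        using le i(1) by (meson order_trans)
      then show False
        using nth_sorted_list_le_iff[OF assms(1) i(1), of x] by simp
    qed
  next
    fix i assume le: "\<forall>x. card (B \<inter> {..x}) \<le> card (A \<inter> {..x})" and i: "i < card A"
    have "i < card (B \<inter> {..sorted_list_of_set B ! i})"
      using nth_sorted_list_le_iff[OF assms(2), of i "sorted_list_of_set B ! i"] i eq by simp
    then show "sorted_list_of_set A ! i \<le> sorted_list_of_set B ! i"
      using nth_sorted_list_le_iff[OF assms(1) i] le by (meson less_le_trans)
  qed
  finally show ?thesis using eq by (simp add: gale_le_def)
qed (simp add: gale_le_def)

lemma card_exchange_Int:
  fixes A :: "nat set"
  assumes "finite A" "a \<in> A" "b \<notin> A"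
  shows "int (card (insert b (A - {a}) \<inter> {..x})) =
    int (card (A \<inter> {..x})) + (if b \<le> x then 1 else 0) - (if a \<le> x then 1 else 0)"
proof -
  let ?C = "A \<inter> {..x} - {a}"
  have "insert b (A - {a}) \<inter> {..x} = (if b \<le> x then insert b ?C else ?C)"
    by auto
  then have "card (insert b (A - {a}) \<inter> {..x}) = card ?C + (if b \<le> x then 1 else 0)"
    using assms by simp
  moreover have "card (A \<inter> {..x}) = card ?C + (if a \<le> x then 1 else 0)"
    using assms card.remove[of "A \<inter> {..x}" a] by (cases "a \<le> x") auto
  ultimately show ?thesis by simp
qed

lemma card_Int_atMost_Suc:
  assumes "finite A"
  shows "card (A \<inter> {..Suc x}) = card (A \<inter> {..x}) + (if Suc x \<in> A then 1 else 0)"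
proof -
  have "A \<inter> {..Suc x} = (if Suc x \<in> A then insert (Suc x) (A \<inter> {..x}) else A \<inter> {..x})"
    by (auto simp: le_Suc_eq)
  then show ?thesis using assms by simp
qed

theorem lpm_matroid:
  assumes "U \<in> nsets {1..n} k" "L \<in> nsets {1..n} k" "U \<le>\<^sub>G L"
  shows "matroid {1..n} (lpm n U L)"
proof
  show "finite {1..n}" by simp
  show "B \<subseteq> {1..n}" if "B \<in> lpm n U L" for B
    using that by (simp add: lpm_def nsets_def)
  have "U \<in> lpm n U L"
    using assms by (auto simp: lpm_def nsets_def gale_le_def)
  then show "lpm n U L \<noteq> {}" by blast
next
  fix A B a assume A: "A \<in> lpm n U L" and B: "B \<in> lpm n U L" and a: "a \<in> A - B"
  have fin: "finite U" "finite L" "finite A" "finite B"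
    and sub: "A \<subseteq> {1..n}" "B \<subseteq> {1..n}"
    and cards: "card A = card U" "card B = card U" "card L = card U"
    using A B assms by (auto simp: lpm_def nsets_def)
  define c where "c X x = int (card (X \<inter> {..x}))" for X :: "nat set" and x
  have "U \<le>\<^sub>G A" "A \<le>\<^sub>G L" "U \<le>\<^sub>G B" "B \<le>\<^sub>G L"
    using A B by (simp_all add: lpm_def)
  then have between: "c L x \<le> c A x" "c A x \<le> c U x" "c L x \<le> c B x" "c B x \<le> c U x" for x
    by (simp_all add: gale_le_iff_count[OF fin(1,3)] gale_le_iff_count[OF fin(3,2)]
        gale_le_iff_count[OF fin(1,4)] gale_le_iff_count[OF fin(4,2)] c_def)
  have cSuc: "c X (Suc x) = c X x + (if Suc x \<in> X then 1 else 0)" if "finite X" for X x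
    using that by (simp add: c_def card_Int_atMost_Suc)
  have n: "c A n = c B n"
  proof -
    have "A \<inter> {..n} = A" "B \<inter> {..n} = B" using sub by auto
    then show ?thesis using cards by (simp add: c_def)
  qed
  have zero: "c A 0 = 0" "c B 0 = 0"
  proof -
    have "A \<inter> {..0} = {}" "B \<inter> {..0} = {}" using sub by auto
    then show "c A 0 = 0" "c B 0 = 0" by (simp_all add: c_def)
  qed
  obtain a' where a': "a = Suc a'"
    using a sub by (cases a) auto
  have "\<exists>b\<in>B - A. \<forall>x. c L x \<le> c A x + (if b \<le> x then 1 else 0) - (if a \<le> x then 1 else 0)
      \<and> c A x + (if b \<le> x then 1 else 0) - (if a \<le> x then 1 else 0) \<le> c U x"
  proof (cases "c A a > c B a")
    case True
    define P where "P y \<longleftrightarrow> a \<le> y \<and> c A y \<le> c B y" for y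
    define b where "b = (LEAST y. P y)"
    have "P n" using n a sub by (auto simp: P_def)
    then have Pb: "P b" unfolding b_def by (rule LeastI)
    have "a < b" using Pb True by (cases "a = b") (auto simp: P_def)
    then obtain b' where b': "b = Suc b'" "a \<le> b'" by (cases b) auto
    have gt: "c A y > c B y" if "a \<le> y" "y < b" for y
      using that not_less_Least[of y P] by (auto simp: P_def b_def)
    have "c A b' > c B b'" using gt b' by simp
    moreover have "c A b \<le> c B b" using Pb by (simp add: P_def)
    ultimately have "b \<in> B - A"
      using b' fin by (auto simp: cSuc split: if_splits)
    moreover have "c L x \<le> c A x + (if b \<le> x then 1 else 0) - (if a \<le> x then 1 else 0)
        \<and> c A x + (if b \<le> x then 1 else 0) - (if a \<le> x then 1 else 0) \<le> c U x" for x
      using between[of x] gt[of x] \<open>a < b\<close> by auto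
    ultimately show ?thesis by blast
  next
    case False
    then have lt: "c A a' < c B a'" using a a' fin by (simp add: cSuc)
    define P where "P y \<longleftrightarrow> y \<le> a' \<and> c A y \<ge> c B y" for y
    define b' where "b' = (GREATEST y. P y)"
    have P0: "P 0" using zero by (simp add: P_def)
    have bound: "\<And>y. P y \<Longrightarrow> y \<le> a'" by (simp add: P_def)
    have Pb: "P b'" unfolding b'_def using P0 bound by (rule GreatestI_nat)
    have b'a: "b' < a'" using Pb lt by (cases "b' = a'") (auto simp: P_def)
    have gt: "c A y < c B y" if "b' < y" "y \<le> a'" for y
    proof -
      have "\<not> P y"
        using that(1) Greatest_le_nat[of P y a'] bound unfolding b'_def by (meson leD)
      then show ?thesis using that(2) by (simp add: P_def)
    qed
    have "c A (Suc b') < c B (Suc b')" using gt b'a by simp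
    moreover have "c A b' \<ge> c B b'" using Pb by (simp add: P_def)
    ultimately have "Suc b' \<in> B - A"
      using fin by (auto simp: cSuc split: if_splits)
    moreover have "c L x \<le> c A x + (if Suc b' \<le> x then 1 else 0) - (if a \<le> x then 1 else 0)
        \<and> c A x + (if Suc b' \<le> x then 1 else 0) - (if a \<le> x then 1 else 0) \<le> c U x" for x
      using between[of x] gt[of x] b'a a' by auto
    ultimately show ?thesis by blast
  qed
  then obtain b where b: "b \<in> B - A"
    and bnd: "\<And>x. c L x \<le> c (insert b (A - {a})) x"
      "\<And>x. c (insert b (A - {a})) x \<le> c U x"
    using card_exchange_Int[OF fin(3), of a] a unfolding c_def by (metis DiffE)
  define X where "X = insert b (A - {a})"
  have X: "X \<subseteq> {1..n}" "finite X" using b sub fin by (auto simp: X_def)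
  have cardX: "card X = card U"
    using b a fin cards card_Suc_Diff1[of A a] by (simp add: X_def del: card_Diff_singleton)
  have "card (L \<inter> {..x}) \<le> card (X \<inter> {..x})" "card (X \<inter> {..x}) \<le> card (U \<inter> {..x})" for x
    using bnd[of x] unfolding c_def X_def[symmetric] of_nat_le_iff by auto
  then have "U \<le>\<^sub>G X" "X \<le>\<^sub>G L"
    using cardX cards gale_le_iff_count[OF fin(1) X(2)] gale_le_iff_count[OF X(2) fin(2)]
    by metis+
  then have "insert b (A - {a}) \<in> lpm n U L"
    using X cardX by (simp add: lpm_def nsets_def X_def[symmetric])
  then show "\<exists>b\<in>B - A. insert b (A - {a}) \<in> lpm n U L" using b by blast
qed

end

theory Submission
  imports Defs
begin

text \<open>
  Read a set \<open>A\<close> as a lattice path whose height after \<open>x\<close> steps is the number of elements of \<open>A\<close>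
  up to \<open>x\<close>. The bases of \<open>M[U,L]\<close> are then the paths that run between the path \<open>L\<close> (below) and
  the path \<open>U\<close> (above). Exchanging \<open>q\<close> for \<open>p\<close> shifts the stretch of the path between \<open>p\<close> and \<open>q\<close>
  by one unit, so an exchange fails exactly when this stretch touches the boundary towards which
  it would be shifted (\<open>exchange_iff\<close>). Everything below is a discussion of such touching points.

  Sufficiency. Since quotients compose, one good pair \<open>(l, u)\<close> can be removed at a time
  (\<open>quotient_remove_good_pair\<close>). From a basis \<open>B\<close> of \<open>M[U,L]\<close> a suitable \<open>b\<close> is removed, chosen
  after the last point before \<open>l\<close> where \<open>B\<close> touches \<open>L\<close> and not after the first point from \<open>u\<close> on
  where \<open>B\<close> touches \<open>U\<close>. Goodness of the pair makes room for \<open>b\<close>, and lets \<open>b\<close> be chosen such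
  that no touching point relevant for exchanges with \<open>p\<close> is lost.

  Necessity. If \<open>B\<close> touches \<open>L\<close> at \<open>x\<close> and \<open>U\<close> at \<open>y\<close> and \<open>p\<close> lies in between, then all exchanges with
  \<open>p\<close> happen between \<open>x\<close> and \<open>y\<close>. The basis \<open>B' \<subseteq> B\<close> given by the quotient must inherit this,
  and so touches \<open>L'\<close> between \<open>x\<close> and \<open>p\<close> and \<open>U'\<close> between \<open>p\<close> and \<open>y\<close>
  (\<open>touching_basis\<close>). Applied to \<open>B = U\<close> and \<open>B = L\<close>, this gives \<open>U' \<subseteq> U\<close> and \<open>L' \<subseteq> L\<close>. The
  removal of smaller elements lowers the ranks of \<open>l\<close> and \<open>u\<close> equally in the greedy pairing,
  so a pair is good at its turn iff it is good in \<open>M[U,L]\<close>. For a bad pair \<open>(l, u)\<close>, consider the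
  elements strictly between \<open>l\<close> and \<open>u\<close>. If \<open>u < l\<close>, some basis of \<open>M[U,L]\<close> has fewer of them
  than every basis of \<open>M[U',L']\<close> (\<open>removed_pair_height_le\<close>). If \<open>l < u\<close>, some basis of \<open>M[U,L]\<close> touches
  \<open>L\<close> at \<open>l\<close> and \<open>U\<close> just before \<open>u\<close>, and leaves too little height for a basis \<open>B'\<close> as above
  (\<open>removed_pair_distance_le\<close>).
\<close>


section \<open>Heights of lattice paths\<close>

text \<open>Integer values, since heights are subtracted throughout.\<close>

definition height :: "nat set \<Rightarrow> nat \<Rightarrow> int" where
  "height A x = int (card (A \<inter> {..x}))"

lemma height_nonneg: "0 \<le> height A x"
  by (simp add: height_def)

lemma height_0: "A \<subseteq> {1..n} \<Longrightarrow> height A 0 = 0"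
proof -
  assume "A \<subseteq> {1..n}"
  then have "A \<inter> {..0} = {}" by auto
  then show ?thesis by (simp add: height_def)
qed

lemma height_Suc:
  "finite A \<Longrightarrow> height A (Suc x) = height A x + (if Suc x \<in> A then 1 else 0)"
  by (simp add: height_def card_Int_atMost_Suc)

lemma height_above: "A \<subseteq> {1..n} \<Longrightarrow> n \<le> x \<Longrightarrow> height A x = int (card A)"
proof -
  assume "A \<subseteq> {1..n}" "n \<le> x"
  then have "A \<inter> {..x} = A" by auto
  then show ?thesis by (simp add: height_def)
qed

lemma height_mono: "finite A \<Longrightarrow> x \<le> y \<Longrightarrow> height A x \<le> height A y"
  by (auto simp: height_def intro!: card_mono)

lemma height_le_steps:
  assumes "finite A" "x \<le> y"
  shows "height A y \<le> height A x + (int y - int x)"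
  using assms(2)
proof (induction y rule: dec_induct)
  case (step m)
  then show ?case using height_Suc[OF assms(1), of m] by auto
qed simp

lemma height_less:
  assumes "finite A" "a \<in> A" "x < a"
  shows "height A x < height A a"
proof -
  have "a \<in> A \<inter> {..a} - A \<inter> {..x}" using assms by auto
  moreover have "A \<inter> {..x} \<subseteq> A \<inter> {..a}" using assms(3) by auto
  ultimately have "A \<inter> {..x} \<subset> A \<inter> {..a}" by blast
  then show ?thesis using assms(1) by (simp add: height_def psubset_card_mono)
qed

lemma height_less_imp_mem:
  assumes "finite A" "height A x < height A y"
  obtains a where "a \<in> A" "x < a" "a \<le> y"
proof -
  have "\<not> A \<inter> {..y} \<subseteq> A \<inter> {..x}"
    using assms card_mono[of "A \<inter> {..x}" "A \<inter> {..y}"] by (auto simp: height_def)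
  then show thesis using that by force
qed

lemma height_Diff:
  assumes "finite A" "C \<subseteq> A"
  shows "height (A - C) x = height A x - height C x"
proof -
  have "(A - C) \<inter> {..x} = A \<inter> {..x} - C \<inter> {..x}" by auto
  moreover have "C \<inter> {..x} \<subseteq> A \<inter> {..x}" "finite (C \<inter> {..x})"
    using assms finite_subset by auto
  ultimately show ?thesis using assms
    by (simp add: height_def card_Diff_subset card_mono of_nat_diff)
qed

lemma height_remove:
  assumes "finite A" "a \<in> A"
  shows "height (A - {a}) x = height A x - (if a \<le> x then 1 else 0)"
proof -
  have "{a} \<inter> {..x} = (if a \<le> x then {a} else {})" by auto
  then show ?thesis using height_Diff[of A "{a}" x] assms by (simp add: height_def)
qed

lemma height_exchange:
  assumes "finite A" "q \<in> A" "p \<notin> A"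
  shows "height ((A \<union> {p}) - {q}) x =
    height A x + (if p \<le> x then 1 else 0) - (if q \<le> x then 1 else 0)"
proof -
  have "(A \<union> {p}) - {q} = insert p (A - {q})" using assms by auto
  then show ?thesis using card_exchange_Int[OF assms, of x] by (simp add: height_def)
qed

lemma gale_le_iff_height:
  assumes "finite A" "finite B"
  shows "A \<le>\<^sub>G B \<longleftrightarrow> card A = card B \<and> (\<forall>x. height B x \<le> height A x)"
  by (simp add: gale_le_iff_count[OF assms] height_def)


section \<open>Bases of a lattice path matroid as paths between two boundaries\<close>

locale lattice_paths =
  fixes n k :: nat and U L :: "nat set"
  assumes U: "U \<in> nsets {1..n} k" and L: "L \<in> nsets {1..n} k" and gale: "U \<le>\<^sub>G L"
begin

lemma upper: "finite U" "U \<subseteq> {1..n}" "card U = k"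
  and lower: "finite L" "L \<subseteq> {1..n}" "card L = k"
  using U L by (auto simp: nsets_def)

lemma lower_le_upper: "height L x \<le> height U x"
  using gale by (simp add: gale_le_iff_height[OF upper(1) lower(1)])

lemma basis_iff:
  "B \<in> lpm n U L \<longleftrightarrow> B \<subseteq> {1..n} \<and> (\<forall>x. height L x \<le> height B x \<and> height B x \<le> height U x)"
proof (cases "B \<subseteq> {1..n}")
  case True
  have fin: "finite B" using True finite_subset by blast
  have "card B = k" if "\<forall>x. height L x \<le> height B x \<and> height B x \<le> height U x"
    using that[rule_format, of n] height_above[of _ n n] True upper lower by simp
  moreover have "B \<in> lpm n U L \<longleftrightarrow>
      card B = k \<and> (\<forall>x. height L x \<le> height B x \<and> height B x \<le> height U x)"
    using True fin gale_le_iff_height[OF upper(1) fin] gale_le_iff_height[OF fin lower(1)]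
    by (auto simp: lpm_def nsets_def upper(3) lower(3))
  ultimately show ?thesis using True by blast
qed (auto simp: lpm_def nsets_def)

lemma basis:
  assumes "B \<in> lpm n U L"
  shows "finite B" "B \<subseteq> {1..n}" "height L x \<le> height B x" "height B x \<le> height U x"
  using assms finite_subset[of B "{1..n}"] by (simp_all add: basis_iff)

lemma bounds_are_bases: "U \<in> lpm n U L" "L \<in> lpm n U L"
  using upper lower lower_le_upper by (auto simp: basis_iff)

text \<open>The exchange lowers the path by one on \<open>q \<le> x < p\<close> or raises it by one on \<open>p \<le> x < q\<close>,
  and changes nothing elsewhere.\<close>

lemma exchange_iff:
  assumes "B \<in> lpm n U L" "p \<in> {1..n} - B" "q \<in> B"
  shows "(B \<union> {p}) - {q} \<in> lpm n U L \<longleftrightarrow>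
    (\<forall>x. q \<le> x \<and> x < p \<longrightarrow> height B x \<noteq> height L x) \<and>
    (\<forall>x. p \<le> x \<and> x < q \<longrightarrow> height B x \<noteq> height U x)"
proof -
  have "(height L x \<le> height ((B \<union> {p}) - {q}) x \<and> height ((B \<union> {p}) - {q}) x \<le> height U x)
    \<longleftrightarrow> (q \<le> x \<and> x < p \<longrightarrow> height B x \<noteq> height L x) \<and>
      (p \<le> x \<and> x < q \<longrightarrow> height B x \<noteq> height U x)" for x
    using basis(3,4)[OF assms(1), of x] assms(2)
      height_exchange[OF basis(1)[OF assms(1)] assms(3), of p x]
    by (cases "p \<le> x"; cases "q \<le> x") auto
  moreover have "(B \<union> {p}) - {q} \<subseteq> {1..n}" using assms basis(2) by blast
  ultimately show ?thesis unfolding basis_iff by blast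
qed

text \<open>Bases can thus be prescribed by their height function, as a maximum or minimum of other paths.\<close>

lemma path_is_basis:
  fixes c :: "nat \<Rightarrow> int"
  assumes between: "\<And>x. height L x \<le> c x" "\<And>x. c x \<le> height U x"
    and step: "\<And>x. c (Suc x) = c x \<or> c (Suc x) = c x + 1"
  obtains B where "B \<in> lpm n U L" "height B = c"
proof -
  define B where "B = {x\<in>{1..n}. c x = c (x - 1) + 1}"
  have fin: "finite B" and sub: "B \<subseteq> {1..n}" by (auto simp: B_def)
  \<comment> \<open>the two boundaries meet at \<open>n\<close>, so all steps up happen at elements of the ground set\<close>
  have top: "c x = int k" if "n \<le> x" for x
    using between[of x] that upper lower by (simp add: height_above)
  have "height B x = c x" for x
  proof (induction x)
    case 0
    show ?case using between[of 0] upper lower sub by (simp add: height_0)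
  next
    case (Suc x)
    have "Suc x \<in> B \<longleftrightarrow> c (Suc x) = c x + 1"
      using top[of x] top[of "Suc x"] by (cases "n \<le> x") (auto simp: B_def)
    then show ?case using step[of x] Suc fin by (auto simp: height_Suc)
  qed
  then have eq: "height B = c" by blast
  with sub between have "B \<in> lpm n U L" by (simp add: basis_iff)
  then show thesis using that eq by blast
qed

text \<open>Take the last element \<open>q \<le> x\<close> of \<open>B\<close>. Its exchange can only be blocked by a touching point
  \<open>t\<close> with \<open>q \<le> t < p\<close>. If \<open>t < x\<close>, then \<open>B\<close> is flat from \<open>t\<close> to \<open>x\<close> while \<open>L\<close> is monotone, so \<open>B\<close>
  still touches \<open>L\<close> at \<open>x\<close>.\<close>

lemma touches_lower:
  assumes B: "B \<in> lpm n U L" and p: "p \<in> {1..n} - B" and x: "x < p"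
    and no: "\<And>q. q \<in> B \<Longrightarrow> q \<le> x \<Longrightarrow> (B \<union> {p}) - {q} \<notin> lpm n U L"
  obtains t where "x \<le> t" "t < p" "height B t = height L t"
proof (cases "height B 0 < height B x")
  case False
  then have "height B x = height L x"
    using height_0[OF basis(2)[OF B]] basis(3)[OF B, of x] height_nonneg[of L x] by simp
  then show ?thesis using that x by blast
next
  case True
  define q where "q = Max (B \<inter> {..x})"
  have "B \<inter> {..x} \<noteq> {}"
    using True basis(1)[OF B] height_less_imp_mem by blast
  then have q: "q \<in> B" "q \<le> x"
    using Max_in[of "B \<inter> {..x}"] by (auto simp: q_def)
  have last: "a \<le> q" if "a \<in> B" "a \<le> x" for a
    using that by (simp add: q_def)
  obtain t where t: "q \<le> t" "t < p" "height B t = height L t"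
    using no[OF q, unfolded exchange_iff[OF B p q(1)]] q x by auto
  show ?thesis
  proof (cases "x \<le> t")
    case False
    have "\<not> height B t < height B x"
      using last t(1) basis(1)[OF B] by (meson height_less_imp_mem leD le_less_trans)
    moreover have "height L t \<le> height L x" using False lower by (simp add: height_mono)
    ultimately have "height B x = height L x" using t basis(3)[OF B, of x] by simp
    then show ?thesis using that x by blast
  qed (use that t in blast)
qed

text \<open>The mirror image, with the first element \<open>q > y\<close> of \<open>B\<close>.\<close>

lemma touches_upper:
  assumes B: "B \<in> lpm n U L" and p: "p \<in> {1..n} - B" and y: "p \<le> y"
    and no: "\<And>q. q \<in> B \<Longrightarrow> y < q \<Longrightarrow> (B \<union> {p}) - {q} \<notin> lpm n U L"
  obtains s where "p \<le> s" "s \<le> y" "height B s = height U s"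
proof (cases "\<exists>q\<in>B. y < q")
  case False
  then have "\<not> height B y < height B (max n y)"
    using basis(1)[OF B] by (meson height_less_imp_mem)
  moreover have "height U y \<le> height U (max n y)" using upper by (simp add: height_mono)
  moreover have "height U (max n y) = height B (max n y)"
    using basis(3,4)[OF B, of "max n y"] upper lower by (simp add: height_above)
  ultimately have "height B y = height U y" using basis(4)[OF B, of y] by simp
  then show ?thesis using that y by blast
next
  case True
  define q where "q = (LEAST q. q \<in> B \<and> y < q)"
  have q: "q \<in> B" "y < q" using LeastI_ex[of "\<lambda>q. q \<in> B \<and> y < q"] True by (auto simp: q_def)
  have first: "q \<le> a" if "a \<in> B" "y < a" for a
    using that by (simp add: q_def Least_le)
  obtain s where s: "p \<le> s" "s < q" "height B s = height U s"
    using no[OF q, unfolded exchange_iff[OF B p q(1)]] q y by auto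
  show ?thesis
  proof (cases "s \<le> y")
    case False
    have "\<not> height B y < height B s"
      using first s(2) basis(1)[OF B] by (meson height_less_imp_mem leD le_less_trans)
    moreover have "height U y \<le> height U s" using False upper by (simp add: height_mono)
    ultimately have "height B y = height U y" using s basis(4)[OF B, of y] by simp
    then show ?thesis using that y by blast
  qed (use that s in blast)
qed

end


section \<open>Removing one good pair\<close>

context lattice_paths
begin

lemma remove_good_pair:
  assumes l: "l \<in> L" and u: "u \<in> U"
    and le: "height L l \<le> height U u"
  shows "lattice_paths n (k - 1) (U - {u}) (L - {l})"
proof
  show "U - {u} \<in> nsets {1..n} (k - 1)" "L - {l} \<in> nsets {1..n} (k - 1)"
    using upper lower l u by (auto simp: nsets_def)
  have "height (L - {l}) x \<le> height (U - {u}) x" for x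
  proof -
    have "height L x < height U x" if "u \<le> x" "x < l"
      using height_mono[OF upper(1) that(1)] height_less[OF lower(1) l that(2)] le by simp
    then show ?thesis using lower_le_upper[of x] upper(1) lower(1) l u
      by (auto simp: height_remove)
  qed
  then show "U - {u} \<le>\<^sub>G L - {l}"
    using upper lower l u by (simp add: gale_le_iff_height)
qed

text \<open>
  Passing to \<open>B - {b}\<close> and to the boundaries without \<open>l\<close> and \<open>u\<close> changes the distance of the path
  from the lower boundary only between \<open>b\<close> and \<open>l\<close>, and from the upper one only between \<open>b\<close> and
  \<open>u\<close>. With \<open>z\<close> the last touching point of \<open>L\<close> before \<open>l\<close> and \<open>w\<close> the first touching point of \<open>U\<close>
  from \<open>u\<close> on, the condition \<open>z < b \<le> w\<close> says that the new path stays between the new boundaries.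
  To be a witness for \<open>p\<close>, it must also keep the touching points that block exchanges with \<open>p\<close>.
  Those in danger are the points \<open>t\<close> of \<open>L\<close> with \<open>l \<le> t < p\<close>, which require \<open>b \<le> t\<close>, and the points
  \<open>s\<close> of \<open>U\<close> with \<open>p \<le> s < u\<close>, which require \<open>s < b\<close>. The bound on \<open>u - l\<close> excludes that both kinds
  exist, so that either the first or the last possible \<open>b\<close> works.
\<close>

lemma quotient_remove_good_pair:
  assumes l: "l \<in> L" and u: "u \<in> U"
    and le: "height L l \<le> height U u" "int u - int l \<le> height U u - height L l"
  shows "matroid_quotient {1..n} (lpm n (U - {u}) (L - {l})) (lpm n U L)"
  unfolding matroid_quotient_def
proof (intro ballI)
  fix B p assume B: "B \<in> lpm n U L" and p: "p \<in> {1..n} - B"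
  interpret Q: lattice_paths n "k - 1" "U - {u}" "L - {l}"
    by (rule remove_good_pair[OF l u le(1)])
  have fin: "finite B" by (rule basis(1)[OF B])
  have l1: "1 \<le> l" and un: "u \<le> n" using l u lower upper by auto
  define z where "z = Max {x. x < l \<and> height B x = height L x}"
  have "0 \<in> {x. x < l \<and> height B x = height L x}"
    using l1 basis(2)[OF B] lower(2) by (auto simp: height_0)
  then have "z \<in> {x. x < l \<and> height B x = height L x}"
    unfolding z_def by (intro Max_in) auto
  then have z: "z < l" "height B z = height L z" by auto
  have z_max: "x \<le> z" if "x < l" "height B x = height L x" for x
    using that by (simp add: z_def)
  define w where "w = (LEAST x. u \<le> x \<and> height B x = height U x)"
  have "height B n = height U n"
    using basis(3,4)[OF B, of n] lower upper by (simp add: height_above)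
  then have w: "u \<le> w" "height B w = height U w"
    using LeastI[of "\<lambda>x. u \<le> x \<and> height B x = height U x" n] un by (auto simp: w_def)
  have w_min: "w \<le> x" if "u \<le> x" "height B x = height U x" for x
    using that by (simp add: w_def Least_le)
  have zl: "height B z < height L l" using z height_less[OF lower(1) l] by simp
  have uw: "height U u \<le> height B w" using w height_mono[OF upper(1)] by simp
  obtain b0 where b0: "b0 \<in> B" "z < b0" "b0 \<le> w"
    using height_less_imp_mem[OF fin, of z w] zl uw le(1) by (metis le_less_trans less_le_trans)
  have "\<exists>b\<in>B. z < b \<and> b \<le> w \<and>
    (\<forall>t. l \<le> t \<and> t < p \<and> height B t = height L t \<longrightarrow> b \<le> t) \<and>
    (\<forall>s. p \<le> s \<and> s < u \<and> height B s = height U s \<longrightarrow> s < b)"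
  proof (cases "\<exists>t. l \<le> t \<and> t < p \<and> height B t = height L t")
    case True
    then obtain t where t: "l \<le> t" "t < p" "height B t = height L t" by blast
    define b where "b = (LEAST b. b \<in> B \<and> z < b)"
    have b: "b \<in> B" "z < b" "b \<le> w"
      using LeastI[of "\<lambda>b. b \<in> B \<and> z < b" b0] Least_le[of "\<lambda>b. b \<in> B \<and> z < b" b0] b0
      by (auto simp: b_def)
    have "b \<le> t" if "l \<le> t" "height B t = height L t" for t
    proof -
      have "height B z < height B t"
        using zl height_mono[OF lower(1) that(1)] that(2) by simp
      then obtain a where "a \<in> B" "z < a" "a \<le> t" using height_less_imp_mem[OF fin] by blast
      then show ?thesis unfolding b_def using Least_le[of "\<lambda>b. b \<in> B \<and> z < b" a] by simp
    qed
    \<comment> \<open>with touching points \<open>t < p \<le> s\<close> of both kinds, the bound on \<open>u - l\<close> would force \<open>B\<close> to rise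
      in every step from \<open>t\<close> to \<open>s\<close>, although \<open>p\<close> is not in \<open>B\<close>\<close>
    moreover have False if s: "p \<le> s" "s < u" "height B s = height U s" for s
    proof -
      obtain p' where p': "p = Suc p'" "t \<le> p'" using t(2) by (cases p) auto
      have "height U u \<le> height B s + (int u - int s)"
        using height_le_steps[OF upper(1), of s u] s by simp
      moreover have "height B s \<le> height B p + (int s - int p)"
        using height_le_steps[OF fin s(1)] .
      moreover have "height B p = height B p'"
        using p p'(1) fin by (simp add: height_Suc)
      moreover have "height B p' \<le> height B t + (int p' - int t)"
        using height_le_steps[OF fin p'(2)] .
      moreover have "height L t \<le> height L l + (int t - int l)"
        using height_le_steps[OF lower(1) t(1)] .
      ultimately show False using le(2) t(3) p'(1) by linarith
    qed
    ultimately show ?thesis using b by blast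
  next
    case False
    define b where "b = Max (B \<inter> {..w})"
    have "b \<in> B \<inter> {..w}" unfolding b_def using b0 by (intro Max_in) auto
    moreover have b_max: "a \<le> b" if "a \<in> B" "a \<le> w" for a
      using that by (simp add: b_def)
    ultimately have b: "b \<in> B" "z < b" "b \<le> w" using b0 by (auto intro: less_le_trans)
    have "s < b" if "s < u" "height B s = height U s" for s
    proof -
      have "height B s < height B w"
        using uw height_less[OF upper(1) u that(1)] that(2) by simp
      then obtain a where "a \<in> B" "s < a" "a \<le> w" using height_less_imp_mem[OF fin] by blast
      then show ?thesis using b_max[of a] by simp
    qed
    then show ?thesis using b False by blast
  qed
  then obtain b where b: "b \<in> B" "z < b" "b \<le> w"
    and b_lower: "\<And>t. \<lbrakk>l \<le> t; t < p; height B t = height L t\<rbrakk> \<Longrightarrow> b \<le> t"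
    and b_upper: "\<And>s. \<lbrakk>p \<le> s; s < u; height B s = height U s\<rbrakk> \<Longrightarrow> s < b"
    by blast
  have hB': "height (B - {b}) x = height B x - (if b \<le> x then 1 else 0)" for x
    using height_remove[OF fin b(1)] .
  have hL': "height (L - {l}) x = height L x - (if l \<le> x then 1 else 0)" for x
    using height_remove[OF lower(1) l] .
  have hU': "height (U - {u}) x = height U x - (if u \<le> x then 1 else 0)" for x
    using height_remove[OF upper(1) u] .
  have B': "B - {b} \<in> lpm n (U - {u}) (L - {l})"
  proof -
    have "height B x \<noteq> height L x" if "b \<le> x" "x < l" for x
      using z_max[of x] that b by auto
    moreover have "height B x \<noteq> height U x" if "u \<le> x" "x < b" for x
      using w_min[of x] that b by auto
    ultimately have "height (L - {l}) x \<le> height (B - {b}) x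
        \<and> height (B - {b}) x \<le> height (U - {u}) x" for x
      using basis(3,4)[OF B, of x] unfolding hB' hL' hU' by (smt (verit) not_le)
    then show ?thesis using basis(2)[OF B] unfolding Q.basis_iff by blast
  qed
  show "\<exists>B'\<in>lpm n (U - {u}) (L - {l}). B' \<subseteq> B \<and>
      (\<forall>q\<in>B'. (B' \<union> {p}) - {q} \<in> lpm n (U - {u}) (L - {l}) \<longrightarrow> (B \<union> {p}) - {q} \<in> lpm n U L)"
  proof (intro bexI[OF _ B'] conjI ballI impI)
    fix q assume q: "q \<in> B - {b}"
      and ex: "(B - {b} \<union> {p}) - {q} \<in> lpm n (U - {u}) (L - {l})"
    have p': "p \<in> {1..n} - (B - {b})" and qB: "q \<in> B" using p q by auto
    note ex' = ex[unfolded Q.exchange_iff[OF B' p' q]]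
    have "height B t \<noteq> height L t" if t: "q \<le> t" "t < p" for t
    proof
      assume eq: "height B t = height L t"
      then have "b \<le> t \<longleftrightarrow> l \<le> t"
        using b_lower[of t] t z_max[of t] b by (cases "l \<le> t") auto
      then show False using ex' t eq by (auto simp: hB' hL')
    qed
    moreover have "height B s \<noteq> height U s" if s: "p \<le> s" "s < q" for s
    proof
      assume eq: "height B s = height U s"
      then have "b \<le> s \<longleftrightarrow> u \<le> s"
        using b_upper[of s] s w_min[of s] b by (cases "u \<le> s") auto
      then show False using ex' s eq by (auto simp: hB' hU')
    qed
    ultimately show "(B \<union> {p}) - {q} \<in> lpm n U L"
      unfolding exchange_iff[OF B p qB] by blast
  qed auto
qed

end

lemma matroid_quotient_refl: "matroid_quotient E \<B> \<B>"
  unfolding matroid_quotient_def by blast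

lemma matroid_quotient_trans:
  assumes 1: "matroid_quotient E \<B>2 \<B>1" and 2: "matroid_quotient E \<B>1 \<B>"
  shows "matroid_quotient E \<B>2 \<B>"
  unfolding matroid_quotient_def
proof (intro ballI)
  fix B p assume B: "B \<in> \<B>" and p: "p \<in> E - B"
  obtain B1 where B1: "B1 \<in> \<B>1" "B1 \<subseteq> B"
    and ex1: "\<forall>q\<in>B1. (B1 \<union> {p}) - {q} \<in> \<B>1 \<longrightarrow> (B \<union> {p}) - {q} \<in> \<B>"
    using 2 B p unfolding matroid_quotient_def by blast
  have "p \<in> E - B1" using p B1 by blast
  then obtain B2 where "B2 \<in> \<B>2" "B2 \<subseteq> B1"
    "\<forall>q\<in>B2. (B2 \<union> {p}) - {q} \<in> \<B>2 \<longrightarrow> (B1 \<union> {p}) - {q} \<in> \<B>1"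
    using 1 B1 unfolding matroid_quotient_def by blast
  then show "\<exists>B2\<in>\<B>2. B2 \<subseteq> B \<and>
      (\<forall>q\<in>B2. (B2 \<union> {p}) - {q} \<in> \<B>2 \<longrightarrow> (B \<union> {p}) - {q} \<in> \<B>)"
    using B1 ex1 by blast
qed


section \<open>Good pairs in terms of heights\<close>

lemma elem_eq_iff:
  assumes "finite A"
  shows "i \<in> {1..card A} \<and> a = elem A i \<longleftrightarrow> a \<in> A \<and> int i = height A a"
proof -
  have elem: "elem A i \<in> A \<and> height A (elem A i) = int i" if "i \<in> {1..card A}" for i
  proof -
    define a where "a = elem A i"
    have i: "i - 1 < card A" using that by auto
    have aA: "a \<in> A"
      unfolding a_def elem_def using assms i by (metis nth_mem set_sorted_list_of_set length_sorted_list_of_set)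
    have "i - 1 < card (A \<inter> {..a})"
      using nth_sorted_list_le_iff[OF assms i, of a] by (simp add: a_def elem_def)
    moreover have "\<not> i < card (A \<inter> {..a})"
    proof
      assume c: "i < card (A \<inter> {..a})"
      have "card (A \<inter> {..a}) \<le> card A" using assms by (simp add: card_mono)
      with c have i': "i < card A" by simp
      then have "sorted_list_of_set A ! i \<le> a"
        using nth_sorted_list_le_iff[OF assms i', of a] c by simp
      moreover have "sorted_list_of_set A ! (i - 1) < sorted_list_of_set A ! i"
        using that i' sorted_wrt_nth_less[OF strict_sorted_list_of_set, of "i - 1" i A] by auto
      ultimately show False by (simp add: a_def elem_def)
    qed
    ultimately show ?thesis using aA that by (simp add: height_def a_def)
  qed
  have "i \<in> {1..card A} \<and> a = elem A i" if a: "a \<in> A" "int i = height A a"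
  proof -
    have i: "i = card (A \<inter> {..a})" using a by (simp add: height_def)
    have "A \<inter> {..a} \<noteq> {}" using a by auto
    then have ir: "i \<in> {1..card A}"
      using i assms by (auto simp: Suc_le_eq card_gt_0_iff card_mono)
    have "elem A i \<in> A" "height A (elem A i) = height A a" using elem[OF ir] a by auto
    then show ?thesis
      using ir height_less[OF assms] a(1) by (metis less_irrefl linorder_neqE_nat)
  qed
  then show ?thesis using elem by metis
qed

text \<open>The position of an element in a set is the height of the path there.\<close>

lemma good_pair_iff_height:
  assumes "finite U" "finite L"
  shows "good_pair U L (l, u) \<longleftrightarrow> l \<in> L \<and> u \<in> U \<and>
    height L l \<le> height U u \<and> int u - int l \<le> height U u - height L l"
proof
  assume "good_pair U L (l, u)"
  then obtain i j where "i \<in> {1..card L} \<and> l = elem L i" "j \<in> {1..card U} \<and> u = elem U j"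
    and "i \<le> j" "int u - int l \<le> int j - int i"
    unfolding good_pair_def by auto
  then show "l \<in> L \<and> u \<in> U \<and>
    height L l \<le> height U u \<and> int u - int l \<le> height U u - height L l"
    unfolding elem_eq_iff[OF assms(1)] elem_eq_iff[OF assms(2)] by simp
next
  assume R: "l \<in> L \<and> u \<in> U \<and>
    height L l \<le> height U u \<and> int u - int l \<le> height U u - height L l"
  define i j where "i = nat (height L l)" and "j = nat (height U u)"
  have ij: "int i = height L l" "int j = height U u" by (simp_all add: i_def j_def height_nonneg)
  have "i \<in> {1..card L} \<and> l = elem L i" "j \<in> {1..card U} \<and> u = elem U j"
    using R ij unfolding elem_eq_iff[OF assms(1)] elem_eq_iff[OF assms(2)] by simp_all
  moreover have "i \<le> j" "int u - int l \<le> int j - int i" using R ij by simp_all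
  ultimately show "good_pair U L (l, u)" unfolding good_pair_def by blast
qed

text \<open>Induction along the pairing. The Gale order of the remaining boundaries has to be carried along,
  because each further step starts from them.\<close>

lemma (in lattice_paths) quotient_good_pairing:
  assumes good: "good_pairing U L ps" and r: "r \<le> length ps"
  shows "lattice_paths n (k - r) (U - snd ` set (take r ps)) (L - fst ` set (take r ps)) \<and>
    matroid_quotient {1..n}
      (lpm n (U - snd ` set (take r ps)) (L - fst ` set (take r ps))) (lpm n U L)"
  using r
proof (induction r)
  case 0
  show ?case using matroid_quotient_refl lattice_paths_axioms by simp
next
  case (Suc r)
  define Ur Lr where "Ur = U - snd ` set (take r ps)" and "Lr = L - fst ` set (take r ps)"
  obtain l u where lu: "ps ! r = (l, u)" by fastforce
  have "take (Suc r) ps = take r ps @ [(l, u)]"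
    using Suc.prems lu by (simp add: take_Suc_conv_app_nth)
  then have next_sets: "U - snd ` set (take (Suc r) ps) = Ur - {u}"
    "L - fst ` set (take (Suc r) ps) = Lr - {l}"
    by (auto simp: Ur_def Lr_def)
  interpret R: lattice_paths n "k - r" Ur Lr using Suc by (simp add: Ur_def Lr_def)
  have "good_pair Ur Lr (l, u)"
    using good Suc.prems lu unfolding good_pairing_def Ur_def Lr_def by (metis Suc_le_eq)
  then have g: "l \<in> Lr" "u \<in> Ur" "height Lr l \<le> height Ur u"
      "int u - int l \<le> height Ur u - height Lr l"
    unfolding good_pair_iff_height[OF R.upper(1) R.lower(1)] by auto
  have "matroid_quotient {1..n} (lpm n Ur Lr) (lpm n U L)"
    using Suc by (simp add: Ur_def Lr_def)
  then have "matroid_quotient {1..n} (lpm n (Ur - {u}) (Lr - {l})) (lpm n U L)"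
    using matroid_quotient_trans R.quotient_remove_good_pair[OF g] by blast
  then show ?case using R.remove_good_pair[OF g(1-3)] unfolding next_sets by simp
qed


section \<open>Quotients of lattice path matroids\<close>

locale lattice_path_quotient =
  M: lattice_paths n k U L + M': lattice_paths n k' U' L'
  for n k k' :: nat and U L U' L' :: "nat set" +
  assumes quotient: "matroid_quotient {1..n} (lpm n U' L') (lpm n U L)"
begin

text \<open>The touching points \<open>x\<close> and \<open>y\<close> confine the fundamental circuit of \<open>p\<close> with respect to \<open>B\<close> to the
  elements between them. The fundamental circuit with respect to \<open>B'\<close> is contained in it, which
  only touching points of \<open>B'\<close> can enforce.\<close>

lemma touching_basis:
  assumes B: "B \<in> lpm n U L" and p: "p \<in> {1..n} - B" and xy: "x < p" "p \<le> y"
    and touch: "height B x = height L x" "height B y = height U y"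
  obtains B' t s where "B' \<in> lpm n U' L'" "B' \<subseteq> B"
    "x \<le> t" "t < p" "height B' t = height L' t"
    "p \<le> s" "s \<le> y" "height B' s = height U' s"
proof -
  obtain B' where B': "B' \<in> lpm n U' L'" "B' \<subseteq> B"
    and ex: "\<And>q. q \<in> B' \<Longrightarrow> (B' \<union> {p}) - {q} \<in> lpm n U' L' \<Longrightarrow> (B \<union> {p}) - {q} \<in> lpm n U L"
    using quotient B p unfolding matroid_quotient_def by blast
  have p': "p \<in> {1..n} - B'" using p B' by blast
  have no: "(B' \<union> {p}) - {q} \<notin> lpm n U' L'" if "q \<in> B'" "q \<le> x \<or> y < q" for q
  proof
    assume "(B' \<union> {p}) - {q} \<in> lpm n U' L'"
    then have "(B \<union> {p}) - {q} \<in> lpm n U L" using ex that by blast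
    then show False
      using M.exchange_iff[OF B p, of q] that B'(2) touch xy by blast
  qed
  obtain t where "x \<le> t" "t < p" "height B' t = height L' t"
    using M'.touches_lower[OF B'(1) p' xy(1)] no by blast
  moreover obtain s where "p \<le> s" "s \<le> y" "height B' s = height U' s"
    using M'.touches_upper[OF B'(1) p' xy(2)] no by blast
  ultimately show thesis using that B' by blast
qed

text \<open>If \<open>p\<close> were in \<open>U'\<close> but not in \<open>U\<close>, then some \<open>B' \<subseteq> U\<close> would touch \<open>U'\<close> at \<open>p\<close>. But \<open>U'\<close> rises at
  \<open>p\<close> and \<open>B'\<close> does not, so \<open>B'\<close> would be above \<open>U'\<close> just before \<open>p\<close>.\<close>

lemma upper_subset: "U' \<subseteq> U"
proof
  fix p assume p: "p \<in> U'"
  show "p \<in> U"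
  proof (rule ccontr)
    assume "p \<notin> U"
    then have pU: "p \<in> {1..n} - U" using p M'.upper by blast
    have start: "height U 0 = height L 0" using M.upper M.lower by (simp add: height_0)
    have "0 < p" using pU by simp
    obtain B' s where B': "B' \<in> lpm n U' L'" "B' \<subseteq> U" and s: "p \<le> s" "s \<le> p" "height B' s = height U' s"
      using touching_basis[OF M.bounds_are_bases(1) pU \<open>0 < p\<close> order_refl start refl] .
    obtain p' where p': "p = Suc p'" using \<open>0 < p\<close> by (cases p) auto
    have "height B' p = height U' p" using s by simp
    moreover have "height B' p = height B' p'"
      using M'.basis(1)[OF B'(1)] B'(2) \<open>p \<notin> U\<close> by (auto simp: p' height_Suc)
    moreover have "height U' p = height U' p' + 1"
      using M'.upper p by (simp add: p' height_Suc)
    ultimately show False using M'.basis(4)[OF B'(1), of p'] by simp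
  qed
qed

text \<open>Dually, some \<open>B' \<subseteq> L\<close> would touch \<open>L'\<close> just before \<open>p\<close> and be below \<open>L'\<close> at \<open>p\<close>.\<close>

lemma lower_subset: "L' \<subseteq> L"
proof
  fix p assume p: "p \<in> L'"
  show "p \<in> L"
  proof (rule ccontr)
    assume "p \<notin> L"
    then have pL: "p \<in> {1..n} - L" using p M'.lower by blast
    have stop: "height L n = height U n" using M.upper M.lower by (simp add: height_above)
    have "0 < p" "p \<le> n" using pL by simp_all
    then obtain p' where p': "p = Suc p'" "p' < p" by (cases p) auto
    obtain B' t where B': "B' \<in> lpm n U' L'" "B' \<subseteq> L" and t: "p' \<le> t" "t < p" "height B' t = height L' t"
      using touching_basis[OF M.bounds_are_bases(2) pL p'(2) \<open>p \<le> n\<close> refl stop] .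
    have "height B' p' = height L' p'" using t p' by (metis less_Suc_eq_le order_antisym)
    moreover have "height B' p = height B' p'"
      using M'.basis(1)[OF B'(1)] B'(2) \<open>p \<notin> L\<close> by (auto simp: p' height_Suc)
    moreover have "height L' p = height L' p' + 1"
      using M'.lower p by (simp add: p' height_Suc)
    ultimately show False using M'.basis(3)[OF B'(1), of p] by simp
  qed
qed

lemma removed_height:
  "height (U - U') x = height U x - height U' x" "height (L - L') x = height L x - height L' x"
  using height_Diff M.upper(1) M.lower(1) upper_subset lower_subset by blast+

lemma removed_height_less:
  assumes "u \<in> U - U'" "x < u"
  shows "height U x - height U' x < height U u - height U' u"
  using height_less[OF _ assms] M.upper(1) by (simp add: removed_height)

lemma removed_height_less_lower:
  assumes "l \<in> L - L'" "x < l"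
  shows "height L x - height L' x < height L l - height L' l"
  using height_less[OF _ assms] M.lower(1) by (simp add: removed_height)

lemma removed_height_mono_lower:
  assumes "x \<le> y"
  shows "height L x - height L' x \<le> height L y - height L' y"
  using height_mono[of "L - L'", OF _ assms] M.lower(1) by (simp add: removed_height)

text \<open>For \<open>k = n\<close> there is no \<open>p\<close> outside of \<open>B\<close>, and being a quotient is a void condition.\<close>

lemma contained_basis:
  assumes "B \<in> lpm n U L" "k < n"
  obtains B' where "B' \<in> lpm n U' L'" "B' \<subseteq> B"
proof -
  have "card B = k" using assms(1) M.upper by (simp add: lpm_def nsets_def)
  then have "\<not> {1..n} \<subseteq> B"
    using assms M.basis(1) card_mono[of B "{1..n}"] by auto
  then obtain p where "p \<in> {1..n} - B" by blast
  then show thesis using quotient assms(1) that unfolding matroid_quotient_def by blast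
qed

lemma height_diff_mono:
  assumes "finite B" "B' \<subseteq> B" "x \<le> y"
  shows "height B' y - height B' x \<le> height B y - height B x"
  using height_mono[of "B - B'", OF _ assms(3)] height_Diff[OF assms(1,2)] assms(1) by simp

text \<open>
  Otherwise \<open>u < l\<close>. Follow \<open>U\<close> up to \<open>u\<close>, then stay flat until \<open>L\<close> is reached, and continue along \<open>L\<close>.
  This basis has \<open>height L l - 1 - height U u\<close> elements strictly between \<open>u\<close> and \<open>l\<close>. As equally
  many elements were removed from \<open>L\<close> up to \<open>l\<close> as from \<open>U\<close> up to \<open>u\<close>, and \<open>l\<close> itself is one of
  them, each basis of the quotient has at least one element more there, and cannot be contained
  in the first one.
\<close>

lemma removed_pair_height_le:
  assumes l: "l \<in> L - L'" and u: "u \<in> U - U'"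
    and rank: "height (L - L') l = height (U - U') u"
  shows "height L l \<le> height U u"
proof (rule ccontr)
  assume less: "\<not> ?thesis"
  have "u < l"
    using less height_mono[OF M.upper(1), of l u] M.lower_le_upper[of l] by force
  then obtain y where y: "l = Suc y" "u \<le> y" by (cases l) auto
  have Ly: "height L l = height L y + 1" "height L' l = height L' y"
    using l M.lower(1) M'.lower(1) by (auto simp: y height_Suc)
  have rank': "height L l - height L' l = height U u - height U' u"
    using rank by (simp add: removed_height)
  show False
  proof (cases "k < n")
    case True
    obtain B where B: "B \<in> lpm n U L"
      and hB: "height B = (\<lambda>x. max (height U (min x u)) (height L x))"
    proof (rule M.path_is_basis)
      fix x
      show "max (height U (min x u)) (height L x) \<le> height U x"
        using M.lower_le_upper[of x] height_mono[OF M.upper(1), of "min x u" x] by simp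
      have "min (Suc x) u = Suc (min x u) \<or> min (Suc x) u = min x u" by auto
      then have "height U (min (Suc x) u) = height U (min x u) \<or>
          height U (min (Suc x) u) = height U (min x u) + 1"
        using height_Suc[OF M.upper(1), of "min x u"] by auto
      moreover have "height L (Suc x) = height L x \<or> height L (Suc x) = height L x + 1"
        using M.lower(1) by (simp add: height_Suc)
      ultimately show "max (height U (min (Suc x) u)) (height L (Suc x)) = max (height U (min x u)) (height L x) \<or>
          max (height U (min (Suc x) u)) (height L (Suc x)) = max (height U (min x u)) (height L x) + 1"
        by linarith
    qed auto
    obtain B' where B': "B' \<in> lpm n U' L'" "B' \<subseteq> B" using contained_basis[OF B True] .
    have "height B' y - height B' u \<le> height B y - height B u"
      using height_diff_mono[OF M.basis(1)[OF B] B'(2) y(2)] .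
    moreover have "height B y = height L y"
      using less y Ly by (simp add: hB min_absorb2)
    moreover have "height B u = height U u"
      using M.lower_le_upper[of u] by (simp add: hB)
    ultimately show False
      using M'.basis(3)[OF B'(1), of y] M'.basis(4)[OF B'(1), of u] rank' Ly by linarith
  next
    \<comment> \<open>only \<open>U' \<le>\<^sub>G L'\<close> is left to use here: up to \<open>u\<close>, fewer elements are missing from \<open>L'\<close> than
      from \<open>U'\<close>\<close>
    case False
    then have "U = {1..n}" "L = {1..n}"
      using M.upper M.lower card_seteq[of "{1..n}" U] card_seteq[of "{1..n}" L] by simp_all
    then show False
      using removed_height_less_lower[OF l \<open>u < l\<close>] M'.lower_le_upper[of u] rank' by simp
  qed
qed

text \<open>
  Otherwise \<open>l < u\<close>. Follow \<open>L\<close> up to \<open>l\<close>, then rise in every step until \<open>U\<close> is reached, and continue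
  along \<open>U\<close>. By assumption this meets \<open>U\<close> before \<open>u\<close> and misses some \<open>p\<close> strictly between \<open>l\<close> and
  \<open>u\<close>. The quotient yields \<open>B' \<subseteq> B\<close> that rises from \<open>L'\<close> at some \<open>t \<ge> l\<close> to \<open>U'\<close> at some \<open>s < u\<close>. But
  fewer elements were removed from \<open>U\<close> up to \<open>s\<close> than from \<open>L\<close> up to \<open>t\<close>, so \<open>B'\<close> would have to rise
  further from \<open>t\<close> to \<open>s\<close> than any path between \<open>L\<close> and \<open>U\<close> that contains it.
\<close>

lemma removed_pair_distance_le:
  assumes l: "l \<in> L - L'" and u: "u \<in> U - U'"
    and rank: "height (L - L') l = height (U - U') u"
  shows "int u - int l \<le> height U u - height L l"
proof (rule ccontr)
  assume less: "\<not> ?thesis"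
  have "l < u"
  proof (rule ccontr)
    assume "\<not> l < u"
    then have "height L l \<le> height L u + (int l - int u)"
      using height_le_steps[OF M.lower(1), of u l] by simp
    then show False using less M.lower_le_upper[of u] by simp
  qed
  then obtain y where y: "u = Suc y" "l \<le> y" by (cases u) auto
  have Uy: "height U u = height U y + 1"
    using u M.upper(1) by (simp add: y height_Suc)
  have rank': "height L l - height L' l = height U u - height U' u"
    using rank by (simp add: removed_height)
  have short: "height U y < height L l + (int y - int l)" using less Uy y by simp
  obtain B where B: "B \<in> lpm n U L"
    and hB: "height B = (\<lambda>x. min (height U x) (height L (min x l) + int (x - l)))"
  proof (rule M.path_is_basis)
    fix x
    have "height L x \<le> height L (min x l) + int (x - l)"
      using height_le_steps[OF M.lower(1), of l x] by (cases "l \<le> x") (auto simp: of_nat_diff)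
    then show "height L x \<le> min (height U x) (height L (min x l) + int (x - l))"
      using M.lower_le_upper[of x] by simp
    have "height L (min (Suc x) l) + int (Suc x - l) = height L (min x l) + int (x - l) \<or>
        height L (min (Suc x) l) + int (Suc x - l) = height L (min x l) + int (x - l) + 1"
      using M.lower(1) by (cases "l \<le> x") (auto simp: height_Suc min_def Suc_diff_le not_le)
    moreover have "height U (Suc x) = height U x \<or> height U (Suc x) = height U x + 1"
      using M.upper(1) by (simp add: height_Suc)
    ultimately show "min (height U (Suc x)) (height L (min (Suc x) l) + int (Suc x - l)) =
          min (height U x) (height L (min x l) + int (x - l)) \<or>
        min (height U (Suc x)) (height L (min (Suc x) l) + int (Suc x - l)) =
          min (height U x) (height L (min x l) + int (x - l)) + 1"
      by linarith
  qed auto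
  have Bl: "height B l = height L l" using M.lower_le_upper[of l] by (simp add: hB)
  have By: "height B y = height U y" using short y by (simp add: hB of_nat_diff)
  have "\<not> {l<..y} \<subseteq> B"
  proof
    assume sub: "{l<..y} \<subseteq> B"
    have "height {l<..y} y - height {l<..y} l \<le> height B y - height B l"
      using height_diff_mono[OF M.basis(1)[OF B] sub y(2)] .
    moreover have "{l<..y} \<inter> {..y} = {l<..y}" "{l<..y} \<inter> {..l} = {}" by auto
    ultimately show False using short Bl By y(2) by (simp add: height_def)
  qed
  then obtain p where p: "l < p" "p \<le> y" "p \<notin> B"
    by (meson greaterThanAtMost_iff subsetI)
  moreover have "u \<le> n" using u M.upper by auto
  ultimately have pB: "p \<in> {1..n} - B" using y by simp
  obtain B' t s where B': "B' \<in> lpm n U' L'" "B' \<subseteq> B"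
    and t: "l \<le> t" "t < p" "height B' t = height L' t"
    and s: "p \<le> s" "s \<le> y" "height B' s = height U' s"
    using touching_basis[OF B pB p(1,2) Bl By] .
  have "height B' s - height B' t \<le> height B s - height B t"
    using height_diff_mono[OF M.basis(1)[OF B] B'(2), of t s] t s by simp
  then show False
    using removed_height_less[OF u, of s] removed_height_mono_lower[OF t(1)] rank'
      M.basis(3)[OF B, of t] M.basis(4)[OF B, of s] t(3) s(2,3) y(1) by simp
qed

end


section \<open>The greedy pairing\<close>

lemma height_nth_sorted:
  assumes "finite A" "r < card A"
  shows "sorted_list_of_set A ! r \<in> A" "height A (sorted_list_of_set A ! r) = int r + 1"
  using elem_eq_iff[OF assms(1), of "Suc r" "sorted_list_of_set A ! r"] assms(2)
  by (auto simp: elem_def)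

text \<open>In the greedy pairing this shift by \<open>r\<close> happens to both boundaries, so the difference of heights
  on which goodness depends is that of \<open>U\<close> and \<open>L\<close>.\<close>

lemma height_drop_first:
  assumes A: "finite A" and C: "C \<subseteq> A" and r: "r < card C"
  shows "sorted_list_of_set C ! r \<in> A - set (take r (sorted_list_of_set C))"
    and "height (A - set (take r (sorted_list_of_set C))) (sorted_list_of_set C ! r) =
      height A (sorted_list_of_set C ! r) - int r"
proof -
  define xs where "xs = sorted_list_of_set C"
  have fin: "finite C" using A C finite_subset by blast
  have xs: "distinct xs" "set xs = C" "length xs = card C" "sorted_wrt (<) xs"
    using fin by (auto simp: xs_def)
  have less: "x < xs ! r" if "x \<in> set (take r xs)" for x
    using that r xs(3) sorted_wrt_nth_less[OF xs(4)] by (auto simp: in_set_conv_nth)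
  have sub: "set (take r xs) \<subseteq> A" using set_take_subset[of r xs] C unfolding xs(2) by (rule order_trans)
  have "set (take r xs) \<inter> {..xs ! r} = set (take r xs)" using less by (auto intro: less_imp_le)
  then have "height (set (take r xs)) (xs ! r) = int r"
    using distinct_card[of "take r xs"] xs r by (simp add: height_def)
  then show "height (A - set (take r xs)) (xs ! r) = height A (xs ! r) - int r"
    using height_Diff[OF A sub] by simp
  have "xs ! r \<in> A" using height_nth_sorted(1)[OF fin r] C by (auto simp: xs_def)
  then show "xs ! r \<in> A - set (take r xs)" using less[of "xs ! r"] by auto
qed

lemma (in lattice_path_quotient) greedy_pairing_good:
  "good_pairing U L (greedy_pairing (L - L') (U - U'))"
  unfolding good_pairing_def
proof (intro allI impI)
  define ls us where "ls = sorted_list_of_set (L - L')" and "us = sorted_list_of_set (U - U')"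
  have fin: "finite (L - L')" "finite (U - U')" using M.upper M.lower by auto
  have len: "length ls = card (L - L')" "length us = card (U - U')" by (simp_all add: ls_def us_def)
  fix r assume "r < length (greedy_pairing (L - L') (U - U'))"
  then have r: "r < card (L - L')" "r < card (U - U')" by (simp_all add: greedy_pairing_def)
  define l u where "l = ls ! r" and "u = us ! r"
  have at: "greedy_pairing (L - L') (U - U') ! r = (l, u)"
    using r by (simp add: greedy_pairing_def l_def u_def ls_def us_def)
  have taken: "fst ` set (take r (greedy_pairing (L - L') (U - U'))) = set (take r ls)"
    "snd ` set (take r (greedy_pairing (L - L') (U - U'))) = set (take r us)"
    using r len unfolding greedy_pairing_def ls_def[symmetric] us_def[symmetric]
    by (simp_all add: take_zip flip: set_map)
  have lu: "l \<in> L - L'" "u \<in> U - U'" "height (L - L') l = height (U - U') u"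
    using height_nth_sorted[OF fin(1) r(1)] height_nth_sorted[OF fin(2) r(2)]
    by (simp_all add: l_def u_def ls_def us_def)
  note dropL = height_drop_first[OF M.lower(1) Diff_subset r(1), folded ls_def, folded l_def]
  note dropU = height_drop_first[OF M.upper(1) Diff_subset r(2), folded us_def, folded u_def]
  show "good_pair (U - snd ` set (take r (greedy_pairing (L - L') (U - U'))))
      (L - fst ` set (take r (greedy_pairing (L - L') (U - U'))))
      (greedy_pairing (L - L') (U - U') ! r)"
    using removed_pair_height_le[OF lu] removed_pair_distance_le[OF lu] M.upper(1) M.lower(1)
      dropL dropU
    unfolding at taken by (simp add: good_pair_iff_height)
qed

theorem theorem19:
  fixes n k k' :: nat and U L U' L' :: "nat set"
  assumes "U \<in> nsets {1..n} k" "L \<in> nsets {1..n} k" "U \<le>\<^sub>G L"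
    and "U' \<in> nsets {1..n} k'" "L' \<in> nsets {1..n} k'" "U' \<le>\<^sub>G L'"
  shows "matroid_quotient {1..n} (lpm n U' L') (lpm n U L) \<longleftrightarrow>
    U' \<subseteq> U \<and> L' \<subseteq> L \<and> good_pairing U L (greedy_pairing (L - L') (U - U'))"
proof
  assume quotient: "matroid_quotient {1..n} (lpm n U' L') (lpm n U L)"
  interpret lattice_path_quotient n k k' U L U' L'
    using assms quotient by unfold_locales
  show "U' \<subseteq> U \<and> L' \<subseteq> L \<and> good_pairing U L (greedy_pairing (L - L') (U - U'))"
    using upper_subset lower_subset greedy_pairing_good by blast
next
  assume R: "U' \<subseteq> U \<and> L' \<subseteq> L \<and> good_pairing U L (greedy_pairing (L - L') (U - U'))"
  interpret M: lattice_paths n k U L using assms by unfold_locales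
  interpret M': lattice_paths n k' U' L' using assms by unfold_locales
  define ps where "ps = greedy_pairing (L - L') (U - U')"
  have "card (L - L') = card (U - U')"
    using R M.upper M.lower M'.upper M'.lower by (simp add: card_Diff_subset)
  then have "fst ` set ps = L - L'" "snd ` set ps = U - U'"
    using M.upper M.lower by (simp_all add: ps_def greedy_pairing_def flip: set_map)
  moreover have "U - (U - U') = U'" "L - (L - L') = L'" using R by auto
  ultimately show "matroid_quotient {1..n} (lpm n U' L') (lpm n U L)"
    using M.quotient_good_pairing[of ps "length ps"] R by (simp add: ps_def)
qed

end
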